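(* Let $\Lambda=\mathrm{diag}(\lambda_1,\dots,\lambda_n)$ with $\lambda_1<\dots<\lambda_n$, and let $g:\mathbb{R}\to\mathbb{R}$ be a smooth function with $g(\lambda_i)\neq g(\lambda_j)$ for all $i\neq j$. Let $X_g$ be the vector field on $\mathcal{T}_\Lambda$ given by $X_g(T)=[T,\Pi_a g(T)]$. Let $M=\mathrm{diag}(\mu_1,\dots,\mu_n)$ with $\mu_1>\mu_2>\dots>\mu_n$ and let $h_{M,g}:\mathcal{T}_\Lambda\to\mathbb{R}$ be $h_{M,g}(T)=\mathrm{tr}(M\,g(T))$. Then the directional derivative $X_g h_{M,g}$ is strictly positive at every non-diagonal $T\in\mathcal{T}_\Lambda$.
   Context: $\mathcal{T}_\Lambda$ denotes the set of real symmetric tridiagonal $n\times n$ matrices with spectrum $\{\lambda_1,\dots,\lambda_n\}$ (a smooth manifold). For a square matrix $A$, $\Pi_a A$ denotes the unique skew-symmetric matrix $S$ with $S_{ij}=A_{ij}$ for $i>j$. $g(T)$ is the matrix function defined by functional calculus. $[A,B]=AB-BA$. The vector field $X_g$ is tangent to $\mathcal{T}_\Lambda$. *)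

theory Defs
  imports "Jordan_Normal_Form.Matrix" "Jordan_Normal_Form.Char_Poly"
begin

definition mat_trace :: "real mat \<Rightarrow> real" where
  "mat_trace A = (\<Sum>i<dim_row A. A $$ (i,i))"

definition commutator :: "real mat \<Rightarrow> real mat \<Rightarrow> real mat" where
  "commutator A B = A * B - B * A"

definition Pi_a :: "real mat \<Rightarrow> real mat" where
  "Pi_a A = mat (dim_row A) (dim_row A)
     (\<lambda>(i,j). if i > j then A $$ (i,j) else if i < j then - A $$ (j,i) else 0)"

definition tridiagonal :: "nat \<Rightarrow> real mat \<Rightarrow> bool" where
  "tridiagonal n T \<longleftrightarrow> T \<in> carrier_mat n n \<and>
     (\<forall>i<n. \<forall>j<n. Suc i < j \<or> Suc j < i \<longrightarrow> T $$ (i,j) = 0)"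

definition iso_tridiag :: "nat \<Rightarrow> (nat \<Rightarrow> real) \<Rightarrow> real mat set" where
  "iso_tridiag n lam = {T. tridiagonal n T \<and> transpose_mat T = T \<and>
      {a. eigenvalue T a} = lam ` {..<n}}"

definition mat_fun :: "(real \<Rightarrow> real) \<Rightarrow> real mat \<Rightarrow> real mat" where
  "mat_fun g T = (SOME G. \<exists>Q d. Q \<in> carrier_mat (dim_row T) (dim_row T) \<and>
      transpose_mat Q * Q = 1\<^sub>m (dim_row T) \<and>
      T = Q * mat_diag (dim_row T) d * transpose_mat Q \<and>
      G = Q * mat_diag (dim_row T) (g \<circ> d) * transpose_mat Q)"

definition smooth_fun :: "(real \<Rightarrow> real) \<Rightarrow> bool" where
  "smooth_fun g \<longleftrightarrow> (\<exists>Ds :: nat \<Rightarrow> real \<Rightarrow> real. Ds 0 = g \<and>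
      (\<forall>k x. (Ds k has_real_derivative Ds (Suc k) x) (at x)))"

definition X_g :: "(real \<Rightarrow> real) \<Rightarrow> real mat \<Rightarrow> real mat" where
  "X_g g T = commutator T (Pi_a (mat_fun g T))"

definition h_Mg :: "real mat \<Rightarrow> (real \<Rightarrow> real) \<Rightarrow> real mat \<Rightarrow> real" where
  "h_Mg M g T = mat_trace (M * mat_fun g T)"

end

theory Submission
  imports Defs "Jordan_Normal_Form.Schur_Decomposition"
begin

text \<open>Put \<open>G = g(T)\<close>, \<open>S = \<Pi>\<^sub>a G\<close> and \<open>X = [T,S]\<close>. The derivative of \<open>g(T + t X)\<close> at \<open>t = 0\<close> is
  \<open>[G,S]\<close>: for symmetric \<open>A\<close>, \<open>B\<close> and any \<open>Z\<close> one has
  \<open>\<parallel>g(B) Z - Z g(A)\<parallel> \<le> L \<parallel>B Z - Z A\<parallel>\<close> in the Frobenius norm, where \<open>L\<close> is a Lipschitz constant of \<open>g\<close>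
  on an interval containing both spectra. With \<open>Z = 1 - t S\<close> the right-hand side for
  \<open>B = T + t X\<close>, \<open>A = T\<close> is \<open>L t\<^sup>2 \<parallel>X S\<parallel>\<close>, so \<open>g(T + t X) = G + t [G,S] + O(t\<^sup>2)\<close>.
  Hence the directional derivative is \<open>tr (M [G,S])\<close>, which equals
  \<open>\<Sum>\<^sub>i\<^sub>k \<bar>\<mu>\<^sub>i - \<mu>\<^sub>k\<bar> G\<^sub>i\<^sub>k\<^sup>2\<close>. It vanishes only if \<open>G\<close> is diagonal, and then \<open>T\<close> is diagonal
  because \<open>g\<close> is injective on the spectrum.\<close>

section \<open>The spectral theorem for real symmetric matrices\<close>

lemma symmetric_mat_entry:
  assumes "A \<in> carrier_mat n n" "transpose_mat A = A" "i < n" "j < n"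
  shows "A $$ (j,i) = A $$ (i,j)"
  using assms by (metis carrier_matD index_transpose_mat(1))

lemma orthogonal_mat_right:
  fixes Q :: "real mat"
  assumes "Q \<in> carrier_mat n n" and "transpose_mat Q * Q = 1\<^sub>m n"
  shows "Q * transpose_mat Q = 1\<^sub>m n"
  using mat_mult_left_right_inverse[of "transpose_mat Q" n Q] assms by simp

text \<open>Over the complex numbers an eigenvalue \<open>a\<close> with eigenvector
  \<open>v\<close> exists. The Hermitian form \<open>s\<close> is its own conjugate and equals
  \<open>a\<close> times the squared norm of \<open>v\<close>, so \<open>a\<close> is real. As
  \<open>A\<close> is real too, the real and imaginary parts of \<open>v\<close> satisfy the same
  equation, and one of them is nonzero.\<close>

lemma symmetric_real_eigenvector:
  fixes A :: "real mat"
  assumes A: "A \<in> carrier_mat n n" and sym: "transpose_mat A = A" and n: "n \<noteq> 0"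
  shows "\<exists>v e. v \<in> carrier_vec n \<and> v \<noteq> 0\<^sub>v n \<and> A *\<^sub>v v = e \<cdot>\<^sub>v v"
proof -
  define B where "B = map_mat complex_of_real A"
  have B: "B \<in> carrier_mat n n" using A by (simp add: B_def)
  obtain as where as: "char_poly B = (\<Prod>a\<leftarrow>as. [:- a, 1:])" "length as = n"
    using char_poly_factorized[OF B] by auto
  obtain a as' where "as = a # as'" using as(2) n by (cases as) auto
  then have "poly (char_poly B) a = 0" by (simp add: as(1))
  then have "eigenvalue B a" using eigenvalue_root_char_poly[OF B] by simp
  then obtain v where v: "v \<in> carrier_vec n" "v \<noteq> 0\<^sub>v n" and ev: "B *\<^sub>v v = a \<cdot>\<^sub>v v"
    unfolding eigenvalue_def eigenvector_def using B by auto
  have eq: "(\<Sum>k<n. complex_of_real (A $$ (i,k)) * v $ k) = a * v $ i" if "i < n" for i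
    using arg_cong[OF ev, of "\<lambda>w. w $ i"] that A v
    by (simp add: B_def scalar_prod_def lessThan_atLeast0)
  have symA: "A $$ (i,k) = A $$ (k,i)" if "i < n" "k < n" for i k
    using symmetric_mat_entry[OF A sym] that by simp
  define N where "N = (\<Sum>i<n. (cmod (v $ i))\<^sup>2)"
  define s where "s = (\<Sum>i<n. \<Sum>k<n. cnj (v $ i) * complex_of_real (A $$ (i,k)) * v $ k)"
  have "s = (\<Sum>i<n. cnj (v $ i) * (a * v $ i))"
    unfolding s_def by (intro sum.cong refl) (simp add: eq[symmetric] sum_distrib_left mult.assoc)
  also have "\<dots> = a * complex_of_real N"
    unfolding N_def of_real_sum sum_distrib_left
    by (intro sum.cong refl) (simp add: complex_norm_square[symmetric, unfolded of_real_power] mult_ac)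
  finally have s: "s = a * complex_of_real N" .
  have "cnj s = (\<Sum>i<n. \<Sum>k<n. cnj (v $ k) * complex_of_real (A $$ (k,i)) * v $ i)"
    unfolding s_def by (auto intro!: sum.cong simp: symA mult_ac)
  also have "\<dots> = s" unfolding s_def by (rule sum.swap)
  finally have "cnj a * complex_of_real N = a * complex_of_real N" by (simp add: s)
  moreover have "N \<noteq> 0"
  proof
    assume "N = 0"
    then have "\<forall>i<n. v $ i = 0" by (simp add: N_def sum_nonneg_eq_0_iff)
    then have "v = 0\<^sub>v n" using v(1) by (intro eq_vecI) auto
    then show False using v(2) by simp
  qed
  ultimately have "cnj a = a" by simp
  then have a: "a = complex_of_real (Re a)" by (metis Reals_cnj_iff of_real_Re)
  have re: "A *\<^sub>v map_vec Re v = Re a \<cdot>\<^sub>v map_vec Re v"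
  proof (rule eq_vecI)
    fix i assume "i < dim_vec (Re a \<cdot>\<^sub>v map_vec Re v)"
    then have i: "i < n" using v by simp
    have "Re (\<Sum>k<n. complex_of_real (A $$ (i,k)) * v $ k) = Re (a * v $ i)" by (simp only: eq[OF i])
    then show "(A *\<^sub>v map_vec Re v) $ i = (Re a \<cdot>\<^sub>v map_vec Re v) $ i"
      using i v A by (subst (asm) a) (simp add: scalar_prod_def lessThan_atLeast0)
  qed (use A v in auto)
  have im: "A *\<^sub>v map_vec Im v = Re a \<cdot>\<^sub>v map_vec Im v"
  proof (rule eq_vecI)
    fix i assume "i < dim_vec (Re a \<cdot>\<^sub>v map_vec Im v)"
    then have i: "i < n" using v by simp
    have "Im (\<Sum>k<n. complex_of_real (A $$ (i,k)) * v $ k) = Im (a * v $ i)" by (simp only: eq[OF i])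
    then show "(A *\<^sub>v map_vec Im v) $ i = (Re a \<cdot>\<^sub>v map_vec Im v) $ i"
      using i v A by (subst (asm) a) (simp add: scalar_prod_def lessThan_atLeast0)
  qed (use A v in auto)
  have "map_vec Re v \<noteq> 0\<^sub>v n \<or> map_vec Im v \<noteq> 0\<^sub>v n"
  proof (rule ccontr)
    assume "\<not> ?thesis"
    then have re0: "map_vec Re v = 0\<^sub>v n" and im0: "map_vec Im v = 0\<^sub>v n" by auto
    have "v = 0\<^sub>v n"
    proof (rule eq_vecI)
      fix i assume i: "i < dim_vec (0\<^sub>v n :: complex vec)"
      show "v $ i = 0\<^sub>v n $ i"
        using arg_cong[OF re0, of "\<lambda>w. w $ i"] arg_cong[OF im0, of "\<lambda>w. w $ i"] i v
        by (simp add: complex_eq_iff)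
    qed (use v in simp)
    then show False using v by simp
  qed
  then show ?thesis using re im v by (metis map_carrier_vec)
qed

text \<open>Complete \<open>v\<close> to a basis, apply Gram-Schmidt, which leaves the first vector
  unchanged, and normalise the columns. This supplies the change of basis for deflating an
  eigenvector.\<close>

lemma orthogonal_first_column:
  fixes v :: "real vec"
  assumes v: "v \<in> carrier_vec n" "v \<noteq> 0\<^sub>v n" and n: "n \<noteq> 0"
  shows "\<exists>U c. U \<in> carrier_mat n n \<and> transpose_mat U * U = 1\<^sub>m n \<and> col U 0 = c \<cdot>\<^sub>v v"
proof -
  interpret cof_vec_space n "TYPE(real)" .
  define b where "b = basis_completion v"
  define ws where "ws = gram_schmidt n b"
  note bc = basis_completion[OF v, folded b_def]
  obtain vs where b: "b = v # vs" using bc(6,7) n by (cases b) auto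
  have ws: "set ws \<subseteq> carrier_vec n" "corthogonal ws" "length ws = n"
    using gram_schmidt_result[OF bc(2,4,5) refl, folded ws_def] bc(6) by auto
  have hd: "ws ! 0 = v"
    using gram_schmidt_hd[OF v(1), of vs, folded b ws_def] ws(3) n by (cases ws) auto
  define r where "r j = sqrt (ws ! j \<bullet> ws ! j)" for j
  define U where "U = mat n n (\<lambda>(i,j). ws ! j $ i / r j)"
  have U: "U \<in> carrier_mat n n" by (simp add: U_def)
  have wsc: "ws ! j \<in> carrier_vec n" if "j < n" for j using ws(1,3) that by auto
  \<comment> \<open>The equivalence includes \<open>i = j\<close>: no vector has zero square, so
    every length \<open>r j\<close> is nonzero.\<close>
  have orth: "ws ! i \<bullet> ws ! j = 0 \<longleftrightarrow> i \<noteq> j" if "i < n" "j < n" for i j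
    using corthogonalD[OF ws(2), of i j] that ws(3) by (simp add: conjugate_vec_def)
  have r: "r j * r j = ws ! j \<bullet> ws ! j" for j
    by (simp add: r_def scalar_prod_def sum_nonneg)
  have "transpose_mat U * U = 1\<^sub>m n"
  proof (rule eq_matI)
    fix i j assume ij: "i < dim_row (1\<^sub>m n :: real mat)" "j < dim_col (1\<^sub>m n :: real mat)"
    then have "(transpose_mat U * U) $$ (i,j) = (\<Sum>k<n. (ws ! i $ k / r i) * (ws ! j $ k / r j))"
      by (simp add: U_def scalar_prod_def lessThan_atLeast0)
    also have "\<dots> = (ws ! i \<bullet> ws ! j) / (r i * r j)"
      using wsc[of j] ij by (simp add: scalar_prod_def sum_divide_distrib lessThan_atLeast0)
    also have "\<dots> = 1\<^sub>m n $$ (i,j)"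
      using orth[of i j] ij r[of i] by auto
    finally show "(transpose_mat U * U) $$ (i,j) = 1\<^sub>m n $$ (i,j)" .
  qed (use U in auto)
  moreover have "col U 0 = (1 / r 0) \<cdot>\<^sub>v v"
    using n v by (intro eq_vecI) (auto simp: U_def hd)
  ultimately show ?thesis using U by blast
qed

lemma mult_block_diag_mat:
  fixes A A' B B' :: "'a :: semiring_0 mat"
  assumes "A \<in> carrier_mat n n" "A' \<in> carrier_mat n n" "B \<in> carrier_mat m m" "B' \<in> carrier_mat m m"
  shows "four_block_mat A (0\<^sub>m n m) (0\<^sub>m m n) B * four_block_mat A' (0\<^sub>m n m) (0\<^sub>m m n) B'
    = four_block_mat (A * A') (0\<^sub>m n m) (0\<^sub>m m n) (B * B')"
  using assms
  by (subst mult_four_block_mat[where ?nr1.0 = n and ?nr2.0 = m and ?n1.0 = n and ?n2.0 = m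
        and ?nc1.0 = n and ?nc2.0 = m]) auto

text \<open>Induction by deflation: conjugating by an orthogonal \<open>U\<close> whose first column
  is an eigenvector splits off a 1 by 1 block, and the induction hypothesis diagonalises the
  remaining symmetric block.\<close>

lemma symmetric_spectral_decomposition:
  fixes A :: "real mat"
  assumes "A \<in> carrier_mat n n" and "transpose_mat A = A"
  shows "\<exists>Q d. Q \<in> carrier_mat n n \<and> transpose_mat Q * Q = 1\<^sub>m n
    \<and> A = Q * mat_diag n d * transpose_mat Q"
  using assms
proof (induction n arbitrary: A)
  case 0
  then show ?case by (intro exI[of _ "1\<^sub>m 0"] exI[of _ "\<lambda>_. 0"]) (auto intro!: eq_matI)
next
  case (Suc m)
  note A = Suc.prems(1) and sym = Suc.prems(2)
  obtain v e where v: "v \<in> carrier_vec (Suc m)" "v \<noteq> 0\<^sub>v (Suc m)" and ev: "A *\<^sub>v v = e \<cdot>\<^sub>v v"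
    using symmetric_real_eigenvector[OF A sym] by auto
  obtain U c where U: "U \<in> carrier_mat (Suc m) (Suc m)" and UU: "transpose_mat U * U = 1\<^sub>m (Suc m)"
    and col0: "col U 0 = c \<cdot>\<^sub>v v"
    using orthogonal_first_column[OF v] by auto
  note UU' = orthogonal_mat_right[OF U UU]
  define B where "B = transpose_mat U * A * U"
  have B: "B \<in> carrier_mat (Suc m) (Suc m)" using U A by (simp add: B_def)
  have symB: "transpose_mat B = B"
    using U A sym by (simp add: B_def transpose_mult[where n = "Suc m" and nr = "Suc m" and nc = "Suc m"]
        assoc_mult_mat[where n\<^sub>1 = "Suc m" and n\<^sub>2 = "Suc m" and n\<^sub>3 = "Suc m" and n\<^sub>4 = "Suc m"])
  have Bi0: "B $$ (i,0) = (if i = 0 then e else 0)" if i: "i < Suc m" for i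
  proof -
    have "A *\<^sub>v col U 0 = e \<cdot>\<^sub>v col U 0"
      using v A ev by (simp add: col0 mult_mat_vec smult_smult_assoc mult.commute)
    then have "col (A * U) 0 = e \<cdot>\<^sub>v col U 0" using A U by (metis col_mult2 zero_less_Suc)
    moreover have "B = transpose_mat U * (A * U)" using U A by (simp add: B_def)
    ultimately have "B $$ (i,0) = e * (col U i \<bullet> col U 0)"
      using i U A by simp
    also have "col U i \<bullet> col U 0 = (transpose_mat U * U) $$ (i,0)" using i U by simp
    finally show ?thesis using i by (simp add: UU)
  qed
  \<comment> \<open>Symmetry carries the vanishing of the first column below the diagonal over to
    the first row.\<close>
  have B0j: "B $$ (0,j) = (if j = 0 then e else 0)" if "j < Suc m" for j
    using symmetric_mat_entry[OF B symB that zero_less_Suc] Bi0[OF that] by simp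
  define C where "C = mat m m (\<lambda>(i,j). B $$ (Suc i, Suc j))"
  have C: "C \<in> carrier_mat m m" by (simp add: C_def)
  have "transpose_mat C = C"
  proof (rule eq_matI)
    fix i j assume "i < dim_row C" "j < dim_col C"
    then show "transpose_mat C $$ (i,j) = C $$ (i,j)"
      using symmetric_mat_entry[OF B symB] by (simp add: C_def)
  qed (use C in auto)
  then obtain Q d where Q: "Q \<in> carrier_mat m m" and QQ: "transpose_mat Q * Q = 1\<^sub>m m"
    and CQ: "C = Q * mat_diag m d * transpose_mat Q"
    using Suc.IH[OF C] by blast
  let ?z = "0\<^sub>m 1 m :: real mat" and ?z' = "0\<^sub>m m 1 :: real mat"
  define R where "R = four_block_mat (1\<^sub>m 1) ?z ?z' Q"
  define D where "D = four_block_mat (mat 1 1 (\<lambda>_. e)) ?z ?z' (mat_diag m d)"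
  have R: "R \<in> carrier_mat (Suc m) (Suc m)" 
    using four_block_carrier_mat[OF one_carrier_mat[of 1] Q] by (simp add: R_def)
  have Rt: "transpose_mat R = four_block_mat (1\<^sub>m 1) ?z ?z' (transpose_mat Q)"
    unfolding R_def using Q by (subst transpose_four_block_mat[where ?nr1.0 = 1 and ?nc1.0 = 1 and ?nr2.0 = m and ?nc2.0 = m]) auto
  have RR: "transpose_mat R * R = 1\<^sub>m (Suc m)"
    unfolding Rt unfolding R_def using Q by (subst mult_block_diag_mat) (auto simp: QQ)
  \<comment> \<open>Indices shift by one: position 0 holds \<open>e\<close> and position
    \<open>Suc k\<close> holds \<open>d k\<close>.\<close>
  have D: "D = mat_diag (Suc m) (case_nat e d)"
    by (rule eq_matI) (auto simp: D_def mat_diag_def split: nat.split)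
  have "B = four_block_mat (mat 1 1 (\<lambda>_. e)) ?z ?z' C"
    using B Bi0 B0j by (intro eq_matI) (auto simp: C_def)
  also have "\<dots> = R * D * transpose_mat R"
    unfolding Rt unfolding R_def D_def using Q
    by (simp add: mult_block_diag_mat CQ del: One_nat_def)
  finally have BR: "B = R * D * transpose_mat R" .
  have Dc: "D \<in> carrier_mat (Suc m) (Suc m)" by (simp add: D)
  note assoc = assoc_mult_mat[where n\<^sub>1 = "Suc m" and n\<^sub>2 = "Suc m" and n\<^sub>3 = "Suc m" and n\<^sub>4 = "Suc m"]
  note tm = transpose_mult[where n = "Suc m" and nr = "Suc m" and nc = "Suc m"]
  have "transpose_mat (U * R) * (U * R) = transpose_mat R * (transpose_mat U * U) * R"
    using U R by (simp add: assoc tm)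
  also have "\<dots> = 1\<^sub>m (Suc m)" using R by (simp add: UU RR)
  finally have orth: "transpose_mat (U * R) * (U * R) = 1\<^sub>m (Suc m)" .
  have "A = (U * transpose_mat U) * A * (U * transpose_mat U)" using A by (simp add: UU')
  also have "\<dots> = U * B * transpose_mat U" unfolding B_def using U A by (simp add: assoc)
  also have "\<dots> = (U * R) * D * transpose_mat (U * R)"
    unfolding BR using U R Dc by (simp add: assoc tm)
  finally show ?case using orth mult_carrier_mat[OF U R] unfolding D by blast
qed

section \<open>Frobenius norm and functional calculus\<close>

text \<open>The square of the Frobenius norm; squaring keeps orthogonal invariance and the
  comparison estimates free of roots.\<close>

definition frob2 :: "real mat \<Rightarrow> real" where
  "frob2 A = (\<Sum>i<dim_row A. \<Sum>j<dim_col A. (A $$ (i,j))\<^sup>2)"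

lemma frob2_carrier: "A \<in> carrier_mat n m \<Longrightarrow> frob2 A = (\<Sum>i<n. \<Sum>j<m. (A $$ (i,j))\<^sup>2)"
  by (auto simp: frob2_def)

lemma frob2_nonneg [simp]: "0 \<le> frob2 A"
  by (simp add: frob2_def sum_nonneg)

lemma entry_le_frob2:
  assumes "A \<in> carrier_mat n m" "i < n" "j < m"
  shows "(A $$ (i,j))\<^sup>2 \<le> frob2 A"
proof -
  have "(A $$ (i,j))\<^sup>2 \<le> (\<Sum>j<m. (A $$ (i,j))\<^sup>2)"
    using assms by (intro member_le_sum) auto
  also have "\<dots> \<le> (\<Sum>i<n. \<Sum>j<m. (A $$ (i,j))\<^sup>2)"
    using assms by (intro member_le_sum) (auto intro: sum_nonneg)
  finally show ?thesis using assms by (simp add: frob2_carrier)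
qed

lemma frob2_transpose: "frob2 (transpose_mat A) = frob2 A"
  unfolding frob2_def by (subst sum.swap) auto

lemma frob2_smult: "frob2 (k \<cdot>\<^sub>m A) = k\<^sup>2 * frob2 A"
  by (simp add: frob2_def power_mult_distrib sum_distrib_left)

lemma frob2_add_le:
  assumes "A \<in> carrier_mat n m" "B \<in> carrier_mat n m"
  shows "frob2 (A + B) \<le> 2 * frob2 A + 2 * frob2 B"
proof -
  have "(x + y)\<^sup>2 \<le> 2 * x\<^sup>2 + 2 * y\<^sup>2" for x y :: real
    using sum_squares_bound[of x y] by (simp add: power2_sum)
  then have "frob2 (A + B) \<le> (\<Sum>i<n. \<Sum>j<m. 2 * (A $$ (i,j))\<^sup>2 + 2 * (B $$ (i,j))\<^sup>2)"
    unfolding frob2_carrier[OF add_carrier_mat[OF assms(2)]] using assms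
    by (intro sum_mono) simp
  also have "\<dots> = 2 * frob2 A + 2 * frob2 B"
    using assms by (simp add: frob2_carrier sum.distrib sum_distrib_left)
  finally show ?thesis .
qed

text \<open>The trace form makes orthogonal invariance algebraic: the factor
  \<open>transpose_mat Q * Q\<close> cancels inside it.\<close>

lemma frob2_trace: "frob2 A = mat_trace (transpose_mat A * A)"
  unfolding frob2_def mat_trace_def
  by (subst sum.swap) (auto simp: scalar_prod_def power2_eq_square lessThan_atLeast0 intro!: sum.cong)

lemma frob2_orthogonal_left:
  assumes Q: "Q \<in> carrier_mat n n" "transpose_mat Q * Q = 1\<^sub>m n" and A: "A \<in> carrier_mat n m"
  shows "frob2 (Q * A) = frob2 A"
proof -
  have "transpose_mat (Q * A) * (Q * A) = transpose_mat A * (transpose_mat Q * Q) * A"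
    using Q(1) A by (simp add: transpose_mult[OF Q(1) A]
        assoc_mult_mat[where n\<^sub>1 = m and n\<^sub>2 = n and n\<^sub>3 = n and n\<^sub>4 = m]
        assoc_mult_mat[where n\<^sub>1 = n and n\<^sub>2 = n and n\<^sub>3 = n and n\<^sub>4 = m])
  also have "\<dots> = transpose_mat A * A" using A by (simp add: Q(2))
  finally show ?thesis by (simp add: frob2_trace)
qed

lemma frob2_orthogonal_right:
  assumes Q: "Q \<in> carrier_mat n n" "transpose_mat Q * Q = 1\<^sub>m n" and A: "A \<in> carrier_mat m n"
  shows "frob2 (A * transpose_mat Q) = frob2 A"
proof -
  have "frob2 (A * transpose_mat Q) = frob2 (Q * transpose_mat A)"
    using transpose_mult[of A m n "transpose_mat Q" n] Q A frob2_transpose[of "A * transpose_mat Q"]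
    by simp
  then show ?thesis using frob2_orthogonal_left[OF Q, of "transpose_mat A"] A
    by (simp add: frob2_transpose)
qed

section \<open>Orthogonal diagonalisations and the functional calculus\<close>

definition orth_diag :: "nat \<Rightarrow> real mat \<Rightarrow> (nat \<Rightarrow> real) \<Rightarrow> real mat \<Rightarrow> bool" where
  "orth_diag n Q d A \<longleftrightarrow> Q \<in> carrier_mat n n \<and> transpose_mat Q * Q = 1\<^sub>m n \<and>
     A = Q * mat_diag n d * transpose_mat Q"

lemma orth_diag_carrier: "orth_diag n Q d A \<Longrightarrow> A \<in> carrier_mat n n"
  unfolding orth_diag_def by (metis mat_diag_dim mult_carrier_mat transpose_carrier_mat)

lemma orth_diag_entry:
  assumes "orth_diag n Q d A" "i < n" "j < n"
  shows "A $$ (i,j) = (\<Sum>k<n. Q $$ (i,k) * d k * Q $$ (j,k))"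
  using assms unfolding orth_diag_def
  by (auto simp: mat_diag_mult_right[of Q n n] scalar_prod_def lessThan_atLeast0)

lemma orth_diag_symmetric:
  assumes "orth_diag n Q d A"
  shows "transpose_mat A = A"
  using orth_diag_carrier[OF assms]
  by (intro eq_matI) (auto simp: orth_diag_entry[OF assms] mult_ac intro!: sum.cong)

lemma orth_diag_mult_right:
  assumes "orth_diag n Q d A"
  shows "A * Q = Q * mat_diag n d"
proof -
  have Q: "Q \<in> carrier_mat n n" "transpose_mat Q * Q = 1\<^sub>m n" 
    and A: "A = Q * mat_diag n d * transpose_mat Q" using assms by (auto simp: orth_diag_def)
  have "A * Q = Q * mat_diag n d * (transpose_mat Q * Q)"
    unfolding A using Q(1) by (intro assoc_mult_mat[of _ n n _ n _ n]) auto
  also have "\<dots> = Q * mat_diag n d" using Q(1) by (simp add: Q(2) right_mult_one_mat[of _ n n])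
  finally show ?thesis .
qed

text \<open>Column \<open>k\<close> of \<open>Q\<close> is a unit eigenvector. This ties the chosen
  values \<open>d k\<close> to the spectrum, on which \<open>g\<close> is known to be
  injective.\<close>

lemma orth_diag_eigenvalue:
  assumes "orth_diag n Q d A" and k: "k < n"
  shows "eigenvalue A (d k)"
proof -
  have Q: "Q \<in> carrier_mat n n" "transpose_mat Q * Q = 1\<^sub>m n" using assms by (auto simp: orth_diag_def)
  note A = orth_diag_carrier[OF assms(1)]
  have "A *\<^sub>v col Q k = col (Q * mat_diag n d) k"
    using orth_diag_mult_right[OF assms(1)] A Q k by (metis col_mult2)
  also have "\<dots> = d k \<cdot>\<^sub>v col Q k"
    using Q k by (intro eq_vecI) (auto simp: mat_diag_mult_right[of Q n n])
  finally have "A *\<^sub>v col Q k = d k \<cdot>\<^sub>v col Q k" .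
  moreover have "col Q k \<noteq> 0\<^sub>v n"
  proof
    assume "col Q k = 0\<^sub>v n"
    moreover have "col Q k \<bullet> col Q k = 1"
      using arg_cong[OF Q(2), of "\<lambda>M. M $$ (k,k)"] Q(1) k by simp
    ultimately show False by simp
  qed
  ultimately show ?thesis using A Q unfolding eigenvalue_def eigenvector_def
    by (intro exI[of _ "col Q k"]) auto
qed

text \<open>By orthogonal invariance \<open>frob2 A\<close> is the sum of all
  \<open>(d k)\<^sup>2\<close>. The bound confines the spectra along a whole segment of matrices to
  one interval.\<close>

lemma orth_diag_eigenvalue_bound:
  assumes "orth_diag n Q d A" and k: "k < n"
  shows "(d k)\<^sup>2 \<le> frob2 A"
proof -
  have Q: "Q \<in> carrier_mat n n" "transpose_mat Q * Q = 1\<^sub>m n" 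
    and A: "A = Q * mat_diag n d * transpose_mat Q" using assms by (auto simp: orth_diag_def)
  have "frob2 A = frob2 (mat_diag n d)"
    unfolding A using Q by (simp add: frob2_orthogonal_right[of Q n _ n] frob2_orthogonal_left[of Q n _ n])
  then show ?thesis using entry_le_frob2[of "mat_diag n d" n n k k] k by (simp add: mat_diag_def)
qed

text \<open>The spectral theorem justifies the choice operator in \<open>mat_fun\<close>. Unpacking
  it gives a single \<open>Q\<close> and \<open>d\<close> serving both \<open>A\<close> and
  \<open>mat_fun g A\<close>; all later facts about \<open>mat_fun\<close> go through this
  pair.\<close>

lemma mat_fun_orth_diag:
  assumes "A \<in> carrier_mat n n" and "transpose_mat A = A"
  obtains Q d where "orth_diag n Q d A" and "orth_diag n Q (g \<circ> d) (mat_fun g A)"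
proof -
  have "\<exists>G Q d. Q \<in> carrier_mat (dim_row A) (dim_row A) \<and> transpose_mat Q * Q = 1\<^sub>m (dim_row A) \<and>
      A = Q * mat_diag (dim_row A) d * transpose_mat Q \<and>
      G = Q * mat_diag (dim_row A) (g \<circ> d) * transpose_mat Q"
    using symmetric_spectral_decomposition[OF assms] assms(1) by auto
  from someI_ex[OF this, folded mat_fun_def] show ?thesis
    using assms(1) that unfolding orth_diag_def by auto
qed

lemma mat_fun_carrier:
  assumes "A \<in> carrier_mat n n" and "transpose_mat A = A"
  shows "mat_fun g A \<in> carrier_mat n n"
  by (rule mat_fun_orth_diag[OF assms, of g]) (rule orth_diag_carrier)

text \<open>In the eigenbases of \<open>A\<close> and \<open>B\<close> the entries of \<open>B Z - Z A\<close> are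
  \<open>(b\<^sub>i - a\<^sub>j) w\<^sub>i\<^sub>j\<close>, and those of \<open>g(B) Z - Z g(A)\<close> are \<open>(g b\<^sub>i - g a\<^sub>j) w\<^sub>i\<^sub>j\<close>, with the same \<open>w\<close>.\<close>

lemma frob2_intertwine:
  assumes A: "orth_diag n Q a A" and B: "orth_diag n R b B" and Z: "Z \<in> carrier_mat n n"
  shows "frob2 (B * Z - Z * A)
    = (\<Sum>i<n. \<Sum>j<n. ((b i - a j) * (transpose_mat R * Z * Q) $$ (i,j))\<^sup>2)"
proof -
  have Q: "Q \<in> carrier_mat n n" "transpose_mat Q * Q = 1\<^sub>m n" 
    and R: "R \<in> carrier_mat n n" "transpose_mat R * R = 1\<^sub>m n" 
    using assms by (auto simp: orth_diag_def)
  note [simp] = orth_diag_carrier[OF A] orth_diag_carrier[OF B] Z Q(1) R(1) mult_carrier_mat[of _ n n _ n]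
  note assoc = assoc_mult_mat[where n\<^sub>1 = n and n\<^sub>2 = n and n\<^sub>3 = n and n\<^sub>4 = n]
  define W where "W = transpose_mat R * Z * Q"
  have W [simp]: "W \<in> carrier_mat n n" unfolding W_def
    by (intro mult_carrier_mat[of _ n n]) auto
  have RB: "transpose_mat R * B = mat_diag n b * transpose_mat R"
  proof -
    have "B = R * (mat_diag n b * transpose_mat R)" using B by (simp add: orth_diag_def assoc)
    then have "transpose_mat R * B = transpose_mat R * R * (mat_diag n b * transpose_mat R)"
      by (simp only: assoc[symmetric] transpose_carrier_mat mat_diag_dim mult_carrier_mat[of _ n n] Q(1) R(1))
    also have "\<dots> = mat_diag n b * transpose_mat R"
      unfolding R(2) by (intro left_mult_one_mat[of _ n n] mult_carrier_mat[of _ n n]) auto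
    finally show ?thesis .
  qed
  have "transpose_mat R * (B * Z - Z * A) * Q = transpose_mat R * (B * Z) * Q - transpose_mat R * (Z * A) * Q"
    by (simp add: mult_minus_distrib_mat[of _ n n _ n] minus_mult_distrib_mat[of _ n n _ _ n])
  also have "transpose_mat R * (B * Z) * Q = (transpose_mat R * B) * Z * Q" by (simp add: assoc)
  also have "\<dots> = mat_diag n b * W" by (simp add: RB assoc W_def)
  also have "transpose_mat R * (Z * A) * Q = transpose_mat R * Z * (A * Q)" by (simp add: assoc)
  also have "\<dots> = W * mat_diag n a" by (simp add: orth_diag_mult_right[OF A] assoc W_def)
  finally have eq: "transpose_mat R * (B * Z - Z * A) * Q = mat_diag n b * W - W * mat_diag n a" .
  \<comment> \<open>The invariance lemmas are applied to the transposed matrices, whose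
    orthogonality is the right-inverse identity.\<close>
  have Rt: "transpose_mat (transpose_mat R) * transpose_mat R = 1\<^sub>m n" 
   and Qt: "transpose_mat (transpose_mat Q) * transpose_mat Q = 1\<^sub>m n"
    using orthogonal_mat_right[OF Q] orthogonal_mat_right[OF R] by auto
  have BZ: "B * Z - Z * A \<in> carrier_mat n n" by (simp add: minus_carrier_mat)
  have "frob2 (transpose_mat R * (B * Z - Z * A) * transpose_mat (transpose_mat Q))
    = frob2 (transpose_mat R * (B * Z - Z * A))"
    by (rule frob2_orthogonal_right[OF _ Qt, where m = n]) (use BZ in auto)
  also have "\<dots> = frob2 (B * Z - Z * A)"
    by (rule frob2_orthogonal_left[OF _ Rt, where m = n]) (use BZ in auto)
  finally have "frob2 (B * Z - Z * A) = frob2 (mat_diag n b * W - W * mat_diag n a)"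
    by (simp add: eq)
  also have "\<dots> = (\<Sum>i<n. \<Sum>j<n. ((b i - a j) * W $$ (i,j))\<^sup>2)"
    using W by (subst frob2_carrier[of _ n n])
      (auto simp: mat_diag_mult_left[of W n n] mat_diag_mult_right[of W n n] algebra_simps minus_carrier_mat intro!: sum.cong)
  finally show ?thesis by (simp add: W_def)
qed

text \<open>The two sums given by \<open>frob2_intertwine\<close> differ only in their weights, so
  they compare term by term, even when \<open>A\<close> and \<open>B\<close> have different
  eigenbases. The constant \<open>c\<close> is the square of a Lipschitz constant.\<close>

lemma frob2_intertwine_le:
  assumes A: "orth_diag n Q a A" "orth_diag n Q (g \<circ> a) A'" 
    and B: "orth_diag n R b B" "orth_diag n R (g \<circ> b) B'"
    and Z: "Z \<in> carrier_mat n n"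
    and lip: "\<And>i j. i < n \<Longrightarrow> j < n \<Longrightarrow> (g (b i) - g (a j))\<^sup>2 \<le> c * (b i - a j)\<^sup>2"
  shows "frob2 (B' * Z - Z * A') \<le> c * frob2 (B * Z - Z * A)"
proof -
  let ?W = "transpose_mat R * Z * Q"
  have "frob2 (B' * Z - Z * A') = (\<Sum>i<n. \<Sum>j<n. (g (b i) - g (a j))\<^sup>2 * (?W $$ (i,j))\<^sup>2)"
    by (simp add: frob2_intertwine[OF A(2) B(2) Z] power_mult_distrib del: index_mult_mat)
  also have "\<dots> \<le> (\<Sum>i<n. \<Sum>j<n. (c * (b i - a j)\<^sup>2) * (?W $$ (i,j))\<^sup>2)"
    by (intro sum_mono mult_right_mono lip) auto
  also have "\<dots> = c * frob2 (B * Z - Z * A)"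
    by (simp add: frob2_intertwine[OF A(1) B(1) Z] power_mult_distrib sum_distrib_left mult_ac del: index_mult_mat)
  finally show ?thesis .
qed

section \<open>Local Lipschitz bounds and quadratic remainders\<close>

lemma smooth_fun_lipschitz_sq:
  assumes "smooth_fun g"
  obtains c where "0 \<le> c"
    and "\<And>x y. \<bar>x\<bar> \<le> K \<Longrightarrow> \<bar>y\<bar> \<le> K \<Longrightarrow> (g x - g y)\<^sup>2 \<le> c * (x - y)\<^sup>2"
proof -
  obtain Ds where D0: "Ds 0 = g"
    and D: "\<And>k x. (Ds k has_real_derivative Ds (Suc k) x) (at x)"
    using assms unfolding smooth_fun_def by blast
  \<comment> \<open>\<open>Ds 1\<close> is the derivative of \<open>g\<close>; being differentiable
    it is continuous, hence bounded on the compact interval. For negative \<open>K\<close> the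
    interval is empty.\<close>
  obtain M where M: "\<And>x. - K \<le> x \<Longrightarrow> x \<le> K \<Longrightarrow> \<bar>Ds 1 x\<bar> \<le> M"
  proof (cases "-K \<le> K")
    case True
    have "\<exists>M. \<forall>x. - K \<le> x \<and> x \<le> K \<longrightarrow> \<bar>Ds 1 x\<bar> \<le> M"
      using D by (intro isCont_bounded[OF True] allI impI continuous_intros) (blast intro: DERIV_isCont)
    then show ?thesis using that by blast
  next
    case False
    then show ?thesis using that by (meson order_trans)
  qed
  \<comment> \<open>Mean value theorem, squared; the order of \<open>x\<close> and \<open>y\<close>
    is removed afterwards by symmetry.\<close>
  have *: "(g x - g y)\<^sup>2 \<le> M\<^sup>2 * (x - y)\<^sup>2" if xy: "x < y" "\<bar>x\<bar> \<le> K" "\<bar>y\<bar> \<le> K" for x y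
  proof -
    obtain z where z: "x < z" "z < y" "g y - g x = (y - x) * Ds 1 z"
      using MVT2[OF xy(1), of g "Ds 1"] D[where k = 0] D0 by auto
    then have "\<bar>Ds 1 z\<bar> \<le> M" using M[of z] xy by linarith
    then have "(Ds 1 z)\<^sup>2 \<le> M\<^sup>2" by (metis abs_ge_zero power2_abs power_mono)
    then have "(y - x)\<^sup>2 * (Ds 1 z)\<^sup>2 \<le> (y - x)\<^sup>2 * M\<^sup>2" by (intro mult_left_mono) auto
    then show ?thesis by (simp add: power2_commute[of "g x"] power2_commute[of x] z(3) power_mult_distrib mult.commute)
  qed
  have "(g x - g y)\<^sup>2 \<le> M\<^sup>2 * (x - y)\<^sup>2" if "\<bar>x\<bar> \<le> K" "\<bar>y\<bar> \<le> K" for x y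
    using *[of x y] *[of y x] that by (cases x y rule: linorder_cases) (auto simp: power2_commute)
  then show ?thesis using that[of "M\<^sup>2"] by simp
qed

text \<open>Dividing the remainder by \<open>\<bar>t\<bar>\<close> leaves at most
  \<open>C * \<bar>t\<bar>\<close>, which tends to zero.\<close>

lemma quadratic_remainder_has_real_derivative:
  fixes f :: "real \<Rightarrow> real"
  assumes "\<And>t. \<bar>t\<bar> \<le> 1 \<Longrightarrow> \<bar>f t - f 0 - t * D\<bar> \<le> C * t\<^sup>2"
  shows "(f has_real_derivative D) (at 0)"
proof -
  have "((\<lambda>t. (f t - f 0) / t - D) \<longlongrightarrow> 0) (at 0)"
  proof (rule tendsto_rabs_zero_cancel, rule tendsto_sandwich[OF _ _ tendsto_const])
    have "\<forall>\<^sub>F t in at 0. \<bar>t::real\<bar> < 1 \<and> t \<noteq> 0"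
      unfolding eventually_at by (intro exI[of _ 1]) auto
    then show "\<forall>\<^sub>F t in at 0. \<bar>(f t - f 0) / t - D\<bar> \<le> C * \<bar>t\<bar>"
    proof (rule eventually_mono)
      fix t :: real assume t: "\<bar>t\<bar> < 1 \<and> t \<noteq> 0"
      have "\<bar>(f t - f 0) / t - D\<bar> = \<bar>f t - f 0 - t * D\<bar> / \<bar>t\<bar>"
        using t by (simp add: abs_divide[symmetric] diff_divide_distrib)
      also have "\<dots> \<le> C * t\<^sup>2 / \<bar>t\<bar>" using assms[of t] t by (intro divide_right_mono) auto
      also have "\<dots> = C * \<bar>t\<bar>" using t by (simp add: field_simps power2_eq_square flip: abs_mult)
      finally show "\<bar>(f t - f 0) / t - D\<bar> \<le> C * \<bar>t\<bar>" .
    qed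
    show "((\<lambda>t. C * \<bar>t\<bar>) \<longlongrightarrow> 0) (at 0)" by (auto intro!: tendsto_eq_intros)
  qed simp
  then show ?thesis by (simp add: DERIV_def LIM_zero_iff)
qed

section \<open>The derivative along a commutator\<close>

lemma commutator_carrier:
  "A \<in> carrier_mat n n \<Longrightarrow> B \<in> carrier_mat n n \<Longrightarrow> commutator A B \<in> carrier_mat n n"
  by (auto simp: commutator_def)

lemma commutator_entry:
  assumes "A \<in> carrier_mat n n" "B \<in> carrier_mat n n" "i < n" "j < n"
  shows "commutator A B $$ (i,j) = (\<Sum>k<n. A $$ (i,k) * B $$ (k,j) - B $$ (i,k) * A $$ (k,j))"
  using assms by (simp add: commutator_def scalar_prod_def lessThan_atLeast0 sum_subtractf)

text \<open>The intertwining estimate is used twice. \<open>Z = 1\<close> shows that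
  \<open>G t - G 0\<close> is O(t); \<open>Z = 1 - t S\<close> gives an O(t^2) error, but with
  \<open>G t * S\<close> in place of \<open>G 0 * S\<close>. The first bound makes that replacement
  cost only O(t^2). Symmetry of the commutator keeps the path inside the symmetric matrices.\<close>

lemma mat_fun_commutator_has_derivative:
  fixes T S :: "real mat"
  assumes g: "smooth_fun g"
    and T: "T \<in> carrier_mat n n" "transpose_mat T = T" and S: "S \<in> carrier_mat n n"
    and symX: "transpose_mat (commutator T S) = commutator T S"
    and ij: "i < n" "j < n"
  shows "((\<lambda>t. mat_fun g (T + t \<cdot>\<^sub>m commutator T S) $$ (i,j))
    has_real_derivative commutator (mat_fun g T) S $$ (i,j)) (at 0)"
proof -
  define X where "X = commutator T S"
  have X: "X \<in> carrier_mat n n" using T(1) S by (simp add: X_def commutator_carrier)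
  define P where "P t = T + t \<cdot>\<^sub>m X" for t
  define G where "G t = mat_fun g (P t)" for t
  have P: "P t \<in> carrier_mat n n" "transpose_mat (P t) = P t" for t
  proof -
    show "P t \<in> carrier_mat n n" using X T by (simp add: P_def)
    show "transpose_mat (P t) = P t"
    proof (rule eq_matI)
      fix i j assume "i < dim_row (P t)" "j < dim_col (P t)"
      then show "transpose_mat (P t) $$ (i,j) = P t $$ (i,j)"
        using symmetric_mat_entry[OF T, of i j] symmetric_mat_entry[OF X symX[folded X_def], of i j] T(1) X
        by (simp add: P_def)
    qed (use X T in \<open>auto simp: P_def\<close>)
  qed
  have P0: "P 0 = T" using T X by (intro eq_matI) (auto simp: P_def)
  have G: "G t \<in> carrier_mat n n" for t
    unfolding G_def by (rule mat_fun_carrier[OF P])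
  \<comment> \<open>For \<open>\<bar>t\<bar> \<le> 1\<close> all eigenvalues of \<open>P t\<close>
    lie between \<open>- K\<close> and \<open>K\<close>, so one constant \<open>c\<close> serves
    every such \<open>t\<close>.\<close>
  define K where "K = sqrt (2 * frob2 T + 2 * frob2 X)"
  obtain c where c: "0 \<le> c"
    and lip: "\<And>x y. \<bar>x\<bar> \<le> K \<Longrightarrow> \<bar>y\<bar> \<le> K \<Longrightarrow> (g x - g y)\<^sup>2 \<le> c * (x - y)\<^sup>2"
    using smooth_fun_lipschitz_sq[OF g] by blast
  have bound: "frob2 (G t * Z - Z * G 0) \<le> c * frob2 (P t * Z - Z * T)"
    if t: "\<bar>t\<bar> \<le> 1" and Z: "Z \<in> carrier_mat n n" for t Z
  proof -
    obtain R b where b: "orth_diag n R b (P t)" "orth_diag n R (g \<circ> b) (G t)"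
      using mat_fun_orth_diag[OF P, of t g] unfolding G_def by blast
    obtain Q a where a: "orth_diag n Q a (P 0)" "orth_diag n Q (g \<circ> a) (G 0)"
      using mat_fun_orth_diag[OF P, of 0 g] unfolding G_def by blast
    have "frob2 (P s) \<le> 2 * frob2 T + 2 * frob2 X" if "\<bar>s\<bar> \<le> 1" for s
    proof -
      have "frob2 (P s) \<le> 2 * frob2 T + 2 * (s\<^sup>2 * frob2 X)"
        using frob2_add_le[of T n n "s \<cdot>\<^sub>m X"] T X by (simp add: P_def frob2_smult)
      also have "s\<^sup>2 * frob2 X \<le> frob2 X"
        using that by (intro mult_left_le_one_le) (auto simp: abs_square_le_1)
      finally show ?thesis by simp
    qed
    then have ev: "\<bar>d k\<bar> \<le> K" if "orth_diag n U d (P s)" "k < n" "\<bar>s\<bar> \<le> 1" for U d s k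
      unfolding K_def using orth_diag_eigenvalue_bound[OF that(1,2)] that(3)
      by (intro real_le_rsqrt) (force simp: power2_abs)
    have "frob2 (G t * Z - Z * G 0) \<le> c * frob2 (P t * Z - Z * P 0)"
      by (rule frob2_intertwine_le[OF a b Z]) (use ev[OF a(1)] ev[OF b(1)] t in \<open>auto intro: lip\<close>)
    then show ?thesis by (simp add: P0)
  qed
  have G1: "frob2 (G t - G 0) \<le> c * frob2 X * t\<^sup>2" if "\<bar>t\<bar> \<le> 1" for t
  proof -
    have "P t * 1\<^sub>m n - 1\<^sub>m n * T = t \<cdot>\<^sub>m X"
      using T X P[of t] by (intro eq_matI) (auto simp: P_def)
    then show ?thesis using bound[OF that, of "1\<^sub>m n"] G[of t] G[of 0]
      by (simp add: frob2_smult mult_ac)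
  qed
  \<comment> \<open>First-order truncation of exp(-tS), which intertwines \<open>T\<close> with
    exp(-tS) T exp(tS), a curve whose velocity at \<open>t = 0\<close> is \<open>X\<close>.\<close>
  define Z where "Z t = 1\<^sub>m n - t \<cdot>\<^sub>m S" for t
  have Z: "Z t \<in> carrier_mat n n" for t using S by (simp add: Z_def minus_carrier_mat)
  have comm: "(A * Z t - Z t * B) $$ (k,l)
      = A $$ (k,l) - B $$ (k,l) - t * ((A * S) $$ (k,l) - (S * B) $$ (k,l))"
    if A: "A \<in> carrier_mat n n" and B: "B \<in> carrier_mat n n" and kl: "k < n" "l < n" for A B t k l
  proof -
    have "A * Z t = A - t \<cdot>\<^sub>m (A * S)"
      using A S by (simp add: Z_def mult_minus_distrib_mat[of _ n n _ n] mult_smult_distrib[of _ n n _ n])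
    moreover have "Z t * B = B - t \<cdot>\<^sub>m (S * B)"
      using B S by (simp add: Z_def minus_mult_distrib_mat[of _ n n _ _ n] mult_smult_assoc_mat[of _ n n _ n])
    ultimately show ?thesis using A B S kl by (simp add: algebra_simps del: index_mult_mat(1))
  qed
  have G2: "frob2 (G t * Z t - Z t * G 0) \<le> c * frob2 (X * S) * (t\<^sup>2)\<^sup>2" if "\<bar>t\<bar> \<le> 1" for t
  proof -
    \<comment> \<open>The constant terms cancel, and the linear ones do so because \<open>X\<close>
      is \<open>T * S - S * T\<close>.\<close>
    have "P t * Z t - Z t * T = (- (t\<^sup>2)) \<cdot>\<^sub>m (X * S)"
    proof (rule eq_matI)
      fix k l assume "k < dim_row ((- (t\<^sup>2)) \<cdot>\<^sub>m (X * S))" "l < dim_col ((- (t\<^sup>2)) \<cdot>\<^sub>m (X * S))"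
      then have kl: "k < n" "l < n" using X S by auto
      have PS: "P t * S = T * S + t \<cdot>\<^sub>m (X * S)"
        using T X S by (simp add: P_def add_mult_distrib_mat[of _ n n _ _ n] mult_smult_assoc_mat[of _ n n _ n])
      have Xkl: "(T * S) $$ (k,l) = X $$ (k,l) + (S * T) $$ (k,l)"
        using kl T S by (simp add: X_def commutator_def del: index_mult_mat(1))
      show "(P t * Z t - Z t * T) $$ (k,l) = ((- (t\<^sup>2)) \<cdot>\<^sub>m (X * S)) $$ (k,l)"
        unfolding comm[OF P(1) T(1) kl] PS using kl T X S Xkl
        by (simp add: P_def algebra_simps power2_eq_square del: index_mult_mat(1))
    qed (use P[of t] Z[of t] T X S in \<open>auto simp: minus_carrier_mat\<close>)
    then show ?thesis using bound[OF that Z[of t]] by (simp add: frob2_smult mult_ac)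
  qed
  \<comment> \<open>The first summand controls the entry of \<open>?E\<close> below, the second the
    entry of \<open>t\<close> times \<open>?F * S\<close>, through column \<open>j\<close> of
    \<open>S\<close>.\<close>
  define C where "C = sqrt (c * frob2 (X * S)) + sqrt (c * frob2 X) * (\<Sum>k<n. \<bar>S $$ (k,j)\<bar>)"
  let ?D = "commutator (G 0) S $$ (i,j)"
  have "\<bar>G t $$ (i,j) - G 0 $$ (i,j) - t * ?D\<bar> \<le> C * t\<^sup>2" if t: "\<bar>t\<bar> \<le> 1" for t
  proof -
    let ?E = "G t * Z t - Z t * G 0" and ?F = "G t - G 0"
    have E: "?E \<in> carrier_mat n n" and F: "?F \<in> carrier_mat n n"
      using mult_carrier_mat[OF Z G] G by (auto simp: minus_carrier_mat)
    have "(?E $$ (i,j))\<^sup>2 \<le> c * frob2 (X * S) * (t\<^sup>2)\<^sup>2"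
      using entry_le_frob2[OF E ij] G2[OF t] by simp
    from real_sqrt_le_mono[OF this] have E1: "\<bar>?E $$ (i,j)\<bar> \<le> sqrt (c * frob2 (X * S)) * t\<^sup>2"
      by (simp only: real_sqrt_mult real_sqrt_abs abs_power2)
    have F1: "\<bar>?F $$ (i,k)\<bar> \<le> sqrt (c * frob2 X) * \<bar>t\<bar>" if "k < n" for k
    proof -
      have "(?F $$ (i,k))\<^sup>2 \<le> c * frob2 X * t\<^sup>2"
        using entry_le_frob2[OF F ij(1) that] G1[OF t] by simp
      from real_sqrt_le_mono[OF this] show ?thesis by (simp only: real_sqrt_mult real_sqrt_abs)
    qed
    have e1: "?E $$ (i,j) = G t $$ (i,j) - G 0 $$ (i,j) - t * ((G t * S) $$ (i,j) - (S * G 0) $$ (i,j))"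
      by (rule comm[OF G G ij])
    have e2: "?D = (G 0 * S) $$ (i,j) - (S * G 0) $$ (i,j)"
      using G[of 0] S ij by (simp add: commutator_def del: index_mult_mat(1))
    have "?F * S = G t * S - G 0 * S"
      by (rule minus_mult_distrib_mat[OF G G S])
    then have e3: "(?F * S) $$ (i,j) = (G t * S) $$ (i,j) - (G 0 * S) $$ (i,j)"
      using G[of 0] S ij by simp
    have "G t $$ (i,j) - G 0 $$ (i,j) - t * ?D = ?E $$ (i,j) + t * (?F * S) $$ (i,j)"
      unfolding e1 e2 e3 right_diff_distrib by linarith
    then have "\<bar>G t $$ (i,j) - G 0 $$ (i,j) - t * ?D\<bar> \<le> \<bar>?E $$ (i,j)\<bar> + \<bar>t\<bar> * \<bar>(?F * S) $$ (i,j)\<bar>"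
      using abs_triangle_ineq[of "?E $$ (i,j)" "t * (?F * S) $$ (i,j)"] by (simp only: abs_mult)
    moreover have "\<bar>t\<bar> * \<bar>(?F * S) $$ (i,j)\<bar> \<le> sqrt (c * frob2 X) * (\<Sum>k<n. \<bar>S $$ (k,j)\<bar>) * t\<^sup>2"
    proof -
      have "(A * S) $$ (i,j) = (\<Sum>k<n. A $$ (i,k) * S $$ (k,j))" if "A \<in> carrier_mat n n" for A
        using that S ij by (simp add: scalar_prod_def lessThan_atLeast0)
      from this[OF F] have "\<bar>(?F * S) $$ (i,j)\<bar> \<le> (\<Sum>k<n. \<bar>?F $$ (i,k)\<bar> * \<bar>S $$ (k,j)\<bar>)"
        using sum_abs[of "\<lambda>k. ?F $$ (i,k) * S $$ (k,j)" "{..<n}"] by (simp only: abs_mult)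
      also have "\<dots> \<le> (\<Sum>k<n. sqrt (c * frob2 X) * \<bar>t\<bar> * \<bar>S $$ (k,j)\<bar>)"
        using F1 by (intro sum_mono mult_right_mono) auto
      finally have "\<bar>t\<bar> * \<bar>(?F * S) $$ (i,j)\<bar>
          \<le> \<bar>t\<bar> * (sqrt (c * frob2 X) * \<bar>t\<bar> * (\<Sum>k<n. \<bar>S $$ (k,j)\<bar>))"
        by (intro mult_left_mono) (simp_all add: sum_distrib_left)
      also have "\<dots> = sqrt (c * frob2 X) * (\<Sum>k<n. \<bar>S $$ (k,j)\<bar>) * \<bar>t\<bar>\<^sup>2"
        unfolding power2_eq_square by (simp only: mult_ac)
      finally show ?thesis by (simp only: power2_abs)
    qed
    ultimately show ?thesis using E1 unfolding C_def distrib_right by linarith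
  qed
  then have "((\<lambda>t. G t $$ (i,j)) has_real_derivative ?D) (at 0)"
    by (rule quadratic_remainder_has_real_derivative)
  then show ?thesis by (simp add: G_def P0) (simp add: P_def X_def)
qed

section \<open>The skew part of a symmetric matrix and the weighted trace\<close>

lemma Pi_a_carrier: "A \<in> carrier_mat n n \<Longrightarrow> Pi_a A \<in> carrier_mat n n"
  by (auto simp: Pi_a_def)

text \<open>Transposition reverses both products and changes the sign of \<open>S\<close>; the two
  effects cancel. This makes the direction \<open>X_g g T\<close> symmetric.\<close>

lemma commutator_skew_symmetric:
  assumes T: "T \<in> carrier_mat n n" "transpose_mat T = T"
    and S: "S \<in> carrier_mat n n" "transpose_mat S = - S"
  shows "transpose_mat (commutator T S) = commutator T S"
proof -
  have symT: "T $$ (k,i) = T $$ (i,k)" if "i < n" "k < n" for i k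
    using symmetric_mat_entry[OF T] that by simp
  have skewS: "S $$ (k,i) = - S $$ (i,k)" if "i < n" "k < n" for i k
    using arg_cong[OF S(2), of "\<lambda>M. M $$ (i,k)"] S(1) that by simp
  have C: "commutator T S \<in> carrier_mat n n" using T S by (simp add: commutator_carrier)
  show ?thesis
  proof (rule eq_matI)
    fix i j assume "i < dim_row (commutator T S)" "j < dim_col (commutator T S)"
    then have ij: "i < n" "j < n" using C by auto
    have "commutator T S $$ (j,i) = commutator T S $$ (i,j)"
      using ij by (auto simp: commutator_entry[OF T(1) S(1)] symT[of i] symT[of j] skewS[of i] skewS[of j] intro!: sum.cong)
    then show "transpose_mat (commutator T S) $$ (i,j) = commutator T S $$ (i,j)" using C ij by simp
  qed (use C in auto)
qed

lemma Pi_a_skew: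
  assumes "A \<in> carrier_mat n n"
  shows "transpose_mat (Pi_a A) = - Pi_a A"
  using assms by (intro eq_matI) (auto simp: Pi_a_def)

text \<open>Symmetrising the double sum in \<open>i\<close> and \<open>k\<close> gives the terms
  \<open>(\<mu>\<^sub>i - \<mu>\<^sub>k) G\<^sub>i\<^sub>k S\<^sub>k\<^sub>i = \<bar>\<mu>\<^sub>i - \<mu>\<^sub>k\<bar> G\<^sub>i\<^sub>k\<^sup>2\<close>.\<close>

lemma weighted_trace_commutator_Pi_a:
  assumes G: "G \<in> carrier_mat n n" "transpose_mat G = G"
    and mu: "\<And>i j. i < j \<Longrightarrow> j < n \<Longrightarrow> mu i > mu j"
  shows "(\<Sum>i<n. mu i * commutator G (Pi_a G) $$ (i,i))
    = (\<Sum>i<n. \<Sum>k<n. \<bar>mu i - mu k\<bar> * (G $$ (i,k))\<^sup>2)"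
proof -
  let ?S = "Pi_a G"
  have symG: "G $$ (k,i) = G $$ (i,k)" if "i < n" "k < n" for i k
    using symmetric_mat_entry[OF G] that by simp
  have S: "?S $$ (i,k) = (if i > k then G $$ (i,k) else if i < k then - G $$ (i,k) else 0)"
    if "i < n" "k < n" for i k
    using that G symG[of i k] by (simp add: Pi_a_def)
  have "(\<Sum>i<n. mu i * commutator G ?S $$ (i,i))
      = (\<Sum>i<n. \<Sum>k<n. mu i * G $$ (i,k) * ?S $$ (k,i)) - (\<Sum>i<n. \<Sum>k<n. mu i * ?S $$ (i,k) * G $$ (k,i))"
    by (simp add: commutator_entry[OF G(1) Pi_a_carrier[OF G(1)]] sum_subtractf sum_distrib_left right_diff_distrib mult.assoc)
  also have "(\<Sum>i<n. \<Sum>k<n. mu i * ?S $$ (i,k) * G $$ (k,i)) = (\<Sum>i<n. \<Sum>k<n. mu k * G $$ (i,k) * ?S $$ (k,i))"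
    by (subst sum.swap) (simp add: mult_ac)
  also have "(\<Sum>i<n. \<Sum>k<n. mu i * G $$ (i,k) * ?S $$ (k,i)) - \<dots>
      = (\<Sum>i<n. \<Sum>k<n. (mu i - mu k) * G $$ (i,k) * ?S $$ (k,i))"
    by (simp add: sum_subtractf left_diff_distrib)
  \<comment> \<open>For \<open>i < k\<close> the difference of weights is positive and
    \<open>?S $$ (k,i)\<close> is \<open>G $$ (i,k)\<close>; for \<open>i > k\<close> both signs
    flip.\<close>
  also have "\<dots> = (\<Sum>i<n. \<Sum>k<n. \<bar>mu i - mu k\<bar> * (G $$ (i,k))\<^sup>2)"
  proof (intro sum.cong refl)
    fix i k assume "i \<in> {..<n}" "k \<in> {..<n}"
    then show "(mu i - mu k) * G $$ (i,k) * ?S $$ (k,i) = \<bar>mu i - mu k\<bar> * (G $$ (i,k))\<^sup>2"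
      using S[of k i] symG[of i k] mu[of i k] mu[of k i]
      by (cases i k rule: linorder_cases) (auto simp: power2_eq_square abs_if algebra_simps)
  qed
  finally show ?thesis .
qed

text \<open>If \<open>G\<close> is diagonal, \<open>G * Q = Q * mat_diag n (g \<circ> d)\<close>
  forces \<open>g (d k) = G $$ (l,l)\<close> wherever \<open>Q $$ (l,k)\<close> is nonzero. By
  injectivity row \<open>i\<close> of \<open>Q\<close> then meets only one eigenvalue, and
  \<open>T $$ (i,j)\<close> is a multiple of an off-diagonal entry of the identity.\<close>

lemma mat_fun_diagonal_imp_diagonal:
  assumes T: "orth_diag n Q d T" and G: "orth_diag n Q (g \<circ> d) G"
    and inj: "inj_on g {a. eigenvalue T a}"
    and diag: "\<And>i j. i < n \<Longrightarrow> j < n \<Longrightarrow> i \<noteq> j \<Longrightarrow> G $$ (i,j) = 0"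
    and ij: "i < n" "j < n" "i \<noteq> j"
  shows "T $$ (i,j) = 0"
proof (rule ccontr)
  assume "T $$ (i,j) \<noteq> 0"
  have Q: "Q \<in> carrier_mat n n" "transpose_mat Q * Q = 1\<^sub>m n" using T by (auto simp: orth_diag_def)
  have row: "G $$ (l,l) = g (d k)" if "l < n" "k < n" "Q $$ (l,k) \<noteq> 0" for l k
  proof -
    have "(G * Q) $$ (l,k) = (\<Sum>m<n. G $$ (l,m) * Q $$ (m,k))"
      using orth_diag_carrier[OF G] Q that by (simp add: scalar_prod_def lessThan_atLeast0)
    also have "\<dots> = (\<Sum>m\<in>{l}. G $$ (l,m) * Q $$ (m,k))"
      using that diag by (intro sum.mono_neutral_right) auto
    finally have "(Q * mat_diag n (g \<circ> d)) $$ (l,k) = G $$ (l,l) * Q $$ (l,k)"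
      by (simp add: orth_diag_mult_right[OF G])
    then show ?thesis using Q that by (simp add: mat_diag_mult_right[of Q n n])
  qed
  \<comment> \<open>A nonzero entry of \<open>T\<close> has a nonzero summand, which provides the
    reference eigenvalue \<open>d k\<close>.\<close>
  obtain k where k: "k < n" "Q $$ (i,k) \<noteq> 0"
    using \<open>T $$ (i,j) \<noteq> 0\<close> unfolding orth_diag_entry[OF T ij(1,2)]
    by (elim sum.not_neutral_contains_not_neutral) auto
  have "d m = d k" if "m < n" "Q $$ (i,m) \<noteq> 0" for m
  proof (rule inj_onD[OF inj])
    show "g (d m) = g (d k)" using row[OF ij(1) that] row[OF ij(1) k] by simp
  qed (simp_all add: orth_diag_eigenvalue[OF T] k that)
  then have "T $$ (i,j) = (\<Sum>m<n. d k * (Q $$ (i,m) * Q $$ (j,m)))"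
    unfolding orth_diag_entry[OF T ij(1,2)] by (intro sum.cong) auto
  also have "\<dots> = d k * (Q * transpose_mat Q) $$ (i,j)"
    using Q ij by (simp add: scalar_prod_def lessThan_atLeast0 sum_distrib_left)
  also have "\<dots> = 0" using ij by (simp add: orthogonal_mat_right[OF Q] del: index_mult_mat)
  finally show False using \<open>T $$ (i,j) \<noteq> 0\<close> by simp
qed

section \<open>Strict positivity at non-diagonal matrices\<close>

theorem theorem2p7:
  fixes n :: nat and lam mu :: "nat \<Rightarrow> real" and g :: "real \<Rightarrow> real" and T :: "real mat"
  assumes lam_incr: "\<And>i j. i < j \<Longrightarrow> j < n \<Longrightarrow> lam i < lam j"
    and g_smooth: "smooth_fun g"
    and g_inj: "\<And>i j. i < n \<Longrightarrow> j < n \<Longrightarrow> i \<noteq> j \<Longrightarrow> g (lam i) \<noteq> g (lam j)"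
    and mu_decr: "\<And>i j. i < j \<Longrightarrow> j < n \<Longrightarrow> mu i > mu j"
    and T_in: "T \<in> iso_tridiag n lam"
    and T_nondiag: "\<exists>i<n. \<exists>j<n. i \<noteq> j \<and> T $$ (i,j) \<noteq> 0"
  shows "\<exists>D. ((\<lambda>t. h_Mg (mat_diag n mu) g (T + t \<cdot>\<^sub>m X_g g T)) has_real_derivative D) (at 0)
             \<and> D > 0"
proof -
  have T: "T \<in> carrier_mat n n" "transpose_mat T = T" and spec: "{a. eigenvalue T a} = lam ` {..<n}"
    using T_in by (auto simp: iso_tridiag_def tridiagonal_def)
  obtain Q d where Q: "orth_diag n Q d T" and QG: "orth_diag n Q (g \<circ> d) (mat_fun g T)"
    using mat_fun_orth_diag[OF T] by blast
  define G where "G = mat_fun g T"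
  have G: "G \<in> carrier_mat n n" "transpose_mat G = G"
    using orth_diag_carrier[OF QG] orth_diag_symmetric[OF QG] by (simp_all add: G_def)
  note S = Pi_a_carrier[OF G(1)]
  have symX: "transpose_mat (commutator T (Pi_a G)) = commutator T (Pi_a G)"
    by (rule commutator_skew_symmetric[OF T S Pi_a_skew[OF G(1)]])
  let ?P = "\<lambda>t. T + t \<cdot>\<^sub>m X_g g T"
  have X: "X_g g T = commutator T (Pi_a G)" by (simp add: X_g_def G_def)
  \<comment> \<open>The straight line represents the tangent direction. It may leave the isospectral
    set, but it stays symmetric, so \<open>mat_fun\<close> is still given by a spectral
    decomposition.\<close>
  have sym: "?P t \<in> carrier_mat n n" "transpose_mat (?P t) = ?P t" for t
  proof -
    note Xc = commutator_carrier[OF T(1) S]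
    have "transpose_mat (t \<cdot>\<^sub>m commutator T (Pi_a G)) = t \<cdot>\<^sub>m commutator T (Pi_a G)"
      using Xc symmetric_mat_entry[OF Xc symX] by (intro eq_matI) auto
    then show "?P t \<in> carrier_mat n n" "transpose_mat (?P t) = ?P t"
      unfolding X using T Xc by (auto simp: transpose_add[of T n n])
  qed
  \<comment> \<open>Against a diagonal weight the trace sees only diagonal entries, so entrywise
    differentiation suffices.\<close>
  have h: "h_Mg (mat_diag n mu) g A = (\<Sum>i<n. mu i * mat_fun g A $$ (i,i))"
    if A: "A \<in> carrier_mat n n" "transpose_mat A = A" for A
    using mat_fun_carrier[OF A, of g] by (simp add: h_Mg_def mat_trace_def mat_diag_mult_left[of _ n n])
  have "((\<lambda>t. \<Sum>i<n. mu i * mat_fun g (?P t) $$ (i,i)) has_real_derivative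
      (\<Sum>i<n. mu i * commutator G (Pi_a G) $$ (i,i))) (at 0)"
    unfolding X G_def[symmetric]
    by (intro DERIV_sum DERIV_cmult)
      (auto simp: G_def intro!: mat_fun_commutator_has_derivative[OF g_smooth T S[unfolded G_def] symX[unfolded G_def]])
  then have deriv: "((\<lambda>t. h_Mg (mat_diag n mu) g (?P t)) has_real_derivative
      (\<Sum>i<n. \<Sum>k<n. \<bar>mu i - mu k\<bar> * (G $$ (i,k))\<^sup>2)) (at 0)"
    by (simp add: h[OF sym] weighted_trace_commutator_Pi_a[OF G mu_decr])
  have inj: "inj_on g {a. eigenvalue T a}"
    unfolding spec by (intro inj_onI) (use g_inj in blast)
  \<comment> \<open>Contraposition: an off-diagonal entry of \<open>T\<close> forces one in
    \<open>G\<close>, and its term alone makes the nonnegative sum positive.\<close>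
  obtain i j where ij: "i < n" "j < n" "i \<noteq> j" "G $$ (i,j) \<noteq> 0"
    using mat_fun_diagonal_imp_diagonal[OF Q QG inj] T_nondiag unfolding G_def by blast
  have "mu i \<noteq> mu j" using mu_decr[of i j] mu_decr[of j i] ij by (cases i j rule: linorder_cases) auto
  then have "0 < \<bar>mu i - mu j\<bar> * (G $$ (i,j))\<^sup>2" using ij by simp
  also have "\<dots> \<le> (\<Sum>k<n. \<bar>mu i - mu k\<bar> * (G $$ (i,k))\<^sup>2)"
    using ij by (intro member_le_sum) auto
  also have "\<dots> \<le> (\<Sum>i<n. \<Sum>k<n. \<bar>mu i - mu k\<bar> * (G $$ (i,k))\<^sup>2)"
    using ij by (intro member_le_sum) (auto intro!: sum_nonneg)
  finally show ?thesis using deriv by blast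
qed

end
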